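(* Let $p(x)=\sum_{k=0}^{n}\binom{n}{k}a_kx^k$ be a real polynomial of degree $n$ in binomial form, with all coefficients $a_0,\dots,a_n$ nonzero, and with all quadratic elements $A_k=a_k^2-a_{k-1}a_{k+1}$, $1\le k\le n-1$, nonzero. Let $\lambda_1,\dots,\lambda_n$ be the zeros of $p$, $\mu_1,\dots,\mu_{n-1}$ the zeros of $p'$, and $\nu_1,\dots,\nu_{n-2}$ the zeros of $p''$. Then $$\frac{A_1}{A_{n-1}}=\frac{a_0^2}{a_n^2}\,\frac{\sum_{i>j}\left(\frac1{\lambda_i}-\frac1{\lambda_j}\right)^2}{\sum_{i>j}(\lambda_i-\lambda_j)^2},\qquad \frac{A_2}{A_{n-1}}=\frac{a_1^2}{a_n^2}\,\frac{\sum_{i>j}\left(\frac1{\mu_i}-\frac1{\mu_j}\right)^2}{\sum_{i>j}(\mu_i-\mu_j)^2},\qquad \frac{A_3}{A_{n-1}}=\frac{a_2^2}{a_n^2}\,\frac{\sum_{i>j}\left(\frac1{\nu_i}-\frac1{\nu_j}\right)^2}{\sum_{i>j}(\nu_i-\nu_j)^2},$$ and so forth (that is, $A_k/A_{n-1}$ is given by the analogous formula with prefactor $a_{k-1}^2/a_n^2$ and with the zeros of the derivative $p^{(k-1)}$). Hence $$\frac{A_1}{A_2}=\frac{a_0^2}{a_1^2}\,\frac{\sum_{i>j}\left(\frac1{\lambda_i}-\frac1{\lambda_j}\right)^2}{\sum_{i>j}\left(\frac1{\mu_i}-\frac1{\mu_j}\right)^2},\qquad \frac{A_1}{A_3}=\frac{a_0^2}{a_2^2}\,\frac{\sum_{i>j}\left(\frac1{\lambda_i}-\frac1{\lambda_j}\right)^2}{\sum_{i>j}\left(\frac1{\nu_i}-\frac1{\nu_j}\right)^2},\qquad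 \frac{A_2}{A_3}=\frac{a_1^2}{a_2^2}\,\frac{\sum_{i>j}\left(\frac1{\mu_i}-\frac1{\mu_j}\right)^2}{\sum_{i>j}\left(\frac1{\nu_i}-\frac1{\nu_j}\right)^2},$$ and so on.
   Context: The zeros are real or complex and listed with multiplicity; sums over $i>j$ run over all pairs of indices of the listed zeros. Each formula is meant for those $n$ for which the quadratic elements occurring in it are defined (i.e. have index between $1$ and $n-1$).
   Formalization: The formulas after "Hence" are false as printed (e.g. n=3, zeros 1, 10, 25); the formula proved for A_j/A_k, j<k, carries the extra factor (n-k+1)^2(n-k)/((n-j+1)^2(n-j)) on the right-hand side. *)

theory Defs
  imports Complex_Main "HOL-Computational_Algebra.Computational_Algebra"
begin

definition binomial_form :: "nat \<Rightarrow> (nat \<Rightarrow> real) \<Rightarrow> real poly" where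
  "binomial_form n a = (\<Sum>k\<le>n. monom (of_nat (n choose k) * a k) k)"

text \<open>Only meant for \<open>k \<ge> 1\<close>.\<close>

definition quadratic_element :: "(nat \<Rightarrow> real) \<Rightarrow> nat \<Rightarrow> real" where
  "quadratic_element a k = (a k)\<^sup>2 - a (k - 1) * a (k + 1)"

definition zeros_of :: "complex list \<Rightarrow> real poly \<Rightarrow> bool" where
  "zeros_of zs p \<longleftrightarrow> mset zs = proots (map_poly complex_of_real p)"

definition sum_sq_diffs :: "complex list \<Rightarrow> complex" where
  "sum_sq_diffs zs = (\<Sum>i<length zs. \<Sum>j<i. (zs ! i - zs ! j)\<^sup>2)"

text \<open>
  If \<open>q\<close> has degree \<open>m\<close> and binomial coefficients \<open>b\<close>, with \<open>b 0 \<noteq> 0\<close>, then the sum below over its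
  zeros is \<open>m\<^sup>2 (m - 1) (b\<^sub>1\<^sup>2 - b\<^sub>0 b\<^sub>2) / b\<^sub>0\<^sup>2\<close>. The degree-dependent factor \<open>m\<^sup>2 (m - 1)\<close> does
  not cancel in a quotient of two such sums taken for derivatives of different orders.
\<close>

definition sum_sq_recip_diffs :: "complex list \<Rightarrow> complex" where
  "sum_sq_recip_diffs zs = (\<Sum>i<length zs. \<Sum>j<i. (1 / zs ! i - 1 / zs ! j)\<^sup>2)"

end

(* Differentiating a polynomial in binomial form shifts its coefficients, up to a constant
   factor, so everything reduces to one polynomial of degree m with binomial coefficients b. By
   Vieta, the sum of squared differences of its zeros, m p_2 - e_1^2 = (m - 1) e_1^2 - 2 m e_2,
   equals m^2 (m - 1) (b_{m-1}^2 - b_{m-2} b_m) / b_m^2. The reciprocal zeros are the zeros of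
   the reflected polynomial, whose binomial coefficients are b in reverse order. *)
theory Submission
  imports Defs
begin

section \<open>Binomial forms and their derivatives\<close>

lemma coeff_binomial_form:
  "coeff (binomial_form n a) k = real (n choose k) * a k"
proof -
  have "coeff (binomial_form n a) k = (\<Sum>i\<le>n. if i = k then real (n choose i) * a i else 0)"
    by (simp add: binomial_form_def coeff_sum)
  also have "\<dots> = real (n choose k) * a k"
    by (simp add: sum.delta)
  finally show ?thesis .
qed

lemma degree_binomial_form:
  assumes "a n \<noteq> 0"
  shows "degree (binomial_form n a) = n"
proof (rule antisym)
  show "degree (binomial_form n a) \<le> n"
    by (rule degree_le) (simp add: coeff_binomial_form)
  show "n \<le> degree (binomial_form n a)"
    using assms by (intro le_degree) (simp add: coeff_binomial_form)
qed

lemma pderiv_binomial_form: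
  "pderiv (binomial_form (Suc n) a) = smult (real (Suc n)) (binomial_form n (\<lambda>k. a (Suc k)))"
proof (rule poly_eqI)
  fix k
  have "real (Suc k) * real (Suc n choose Suc k) = real (Suc n) * real (n choose k)"
    by (metis Suc_times_binomial of_nat_mult)
  then show "coeff (pderiv (binomial_form (Suc n) a)) k =
      coeff (smult (real (Suc n)) (binomial_form n (\<lambda>k. a (Suc k)))) k"
    unfolding coeff_pderiv coeff_smult coeff_binomial_form by (metis mult.assoc)
qed

text \<open>The constant is \<open>n (n - 1) ... (n - r + 1)\<close>. Only
  \<open>c \<noteq> 0\<close> matters later, since scaling by it leaves the zeros and their
  multiplicities unchanged.\<close>

lemma higher_pderiv_binomial_form:
  assumes "r \<le> n"
  shows "\<exists>c. c \<noteq> 0 \<and>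
    (pderiv ^^ r) (binomial_form n a) = smult c (binomial_form (n - r) (\<lambda>k. a (k + r)))"
  using assms
proof (induction r)
  case 0
  show ?case by (intro exI[of _ 1]) simp
next
  case (Suc r)
  then obtain c where c: "c \<noteq> 0"
    and eq: "(pderiv ^^ r) (binomial_form n a) = smult c (binomial_form (n - r) (\<lambda>k. a (k + r)))"
    by auto
  obtain m where m: "n - r = Suc m" "n - Suc r = m"
    using Suc.prems by (metis Suc_diff_Suc Suc_le_eq)
  have "(pderiv ^^ Suc r) (binomial_form n a) =
      smult (c * real (Suc m)) (binomial_form m (\<lambda>k. a (k + Suc r)))"
    by (simp add: eq m pderiv_smult pderiv_binomial_form del: of_nat_Suc)
  moreover have "c * real (Suc m) \<noteq> 0"
    using c by simp
  ultimately show ?case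
    unfolding m by blast
qed

lemma map_poly_of_real_smult:
  "map_poly complex_of_real (smult c p) = smult (complex_of_real c) (map_poly complex_of_real p)"
  by (rule poly_eqI) (simp add: coeff_map_poly)

lemma zeros_of_higher_pderiv_binomial_form:
  assumes "r \<le> n"
  shows "zeros_of zs ((pderiv ^^ r) (binomial_form n a)) \<longleftrightarrow>
    zeros_of zs (binomial_form (n - r) (\<lambda>k. a (k + r)))"
proof -
  obtain c where "c \<noteq> 0"
    and "(pderiv ^^ r) (binomial_form n a) = smult c (binomial_form (n - r) (\<lambda>k. a (k + r)))"
    using higher_pderiv_binomial_form[OF assms] by blast
  then show ?thesis
    by (simp add: zeros_of_def map_poly_of_real_smult)
qed

section \<open>Elementary symmetric functions, power sums and squared differences\<close>

text \<open>With factors \<open>[:1, - z:]\<close> the signed elementary symmetric functions sit at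
  the low indices 0, 1, 2, whatever the length of the list, so plain induction works. The last
  equation is Newton's identity for \<open>2 e_2\<close>; keeping the factor 2 avoids
  division.\<close>

lemma coeff_prod_list_one_minus:
  fixes zs :: "'a :: idom list"
  defines "Q \<equiv> \<Prod>z\<leftarrow>zs. [:1, - z:]"
  shows "coeff Q 0 = 1"
    and "coeff Q (Suc 0) = - sum_list zs"
    and "2 * coeff Q 2 = (sum_list zs)\<^sup>2 - (\<Sum>z\<leftarrow>zs. z\<^sup>2)"
proof -
  have "coeff Q 0 = 1 \<and> coeff Q (Suc 0) = - sum_list zs \<and>
      2 * coeff Q 2 = (sum_list zs)\<^sup>2 - (\<Sum>z\<leftarrow>zs. z\<^sup>2)"
    unfolding Q_def
    by (induction zs)
      (auto simp: numeral_2_eq_2 coeff_mult algebra_simps power2_eq_square)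
  then show "coeff Q 0 = 1" "coeff Q (Suc 0) = - sum_list zs"
    "2 * coeff Q 2 = (sum_list zs)\<^sup>2 - (\<Sum>z\<leftarrow>zs. z\<^sup>2)"
    by auto
qed

lemma sum_list_sq_diff_const:
  fixes x :: "'a :: comm_ring_1"
  shows "(\<Sum>z\<leftarrow>zs. (x - z)\<^sup>2) =
    of_nat (length zs) * x\<^sup>2 - 2 * x * sum_list zs + (\<Sum>z\<leftarrow>zs. z\<^sup>2)"
  by (induction zs) (auto simp: algebra_simps power2_eq_square)

lemma sum_sq_diffs_snoc:
  "sum_sq_diffs (zs @ [x]) = sum_sq_diffs zs + (\<Sum>z\<leftarrow>zs. (x - z)\<^sup>2)"
  by (simp add: sum_sq_diffs_def nth_append sum_list_sum_nth atLeast0LessThan)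

text \<open>This is Lagrange's identity for \<open>zs\<close> and the all-ones vector. Induction
  from the right fits because a new last entry leaves the earlier pairs untouched and adds one pair
  with each earlier entry.\<close>

lemma sum_sq_diffs_power_sums:
  "sum_sq_diffs zs = of_nat (length zs) * (\<Sum>z\<leftarrow>zs. z\<^sup>2) - (sum_list zs)\<^sup>2"
proof (induction zs rule: rev_induct)
  case Nil
  show ?case by (simp add: sum_sq_diffs_def)
next
  case (snoc x zs)
  have "sum_sq_diffs (zs @ [x]) =
      of_nat (length zs) * (\<Sum>z\<leftarrow>zs. z\<^sup>2) - (sum_list zs)\<^sup>2 +
      (of_nat (length zs) * x\<^sup>2 - 2 * x * sum_list zs + (\<Sum>z\<leftarrow>zs. z\<^sup>2))"
    by (simp only: sum_sq_diffs_snoc sum_list_sq_diff_const snoc.IH)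
  then show ?case
    by (simp add: algebra_simps power2_sum)
qed

lemma sum_sq_recip_diffs_eq:
  "sum_sq_recip_diffs zs = sum_sq_diffs (map inverse zs)"
  by (simp add: sum_sq_recip_diffs_def sum_sq_diffs_def divide_inverse)

section \<open>Factorisation over the zeros and reflection\<close>

lemma complex_poly_decompose_list:
  fixes p :: "complex poly"
  assumes "mset zs = proots p"
  shows "p = smult (lead_coeff p) (\<Prod>z\<leftarrow>zs. [:- z, 1:])"
proof -
  have "p = smult (lead_coeff p) (\<Prod>z\<in>#proots p. [:- z, 1:])"
    by (rule complex_poly_decompose_multiset [symmetric])
  also have "(\<Prod>z\<in>#proots p. [:- z, 1:]) = (\<Prod>z\<leftarrow>zs. [:- z, 1:])"
    by (subst prod_mset_prod_list [symmetric]) (simp add: assms)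
  finally show ?thesis .
qed

lemma reflect_poly_linear: "reflect_poly [:- z, 1:] = [:1, - z :: complex:]"
  by (cases "z = 0") (simp_all add: reflect_poly_def)

text \<open>Reflection is multiplicative and reverses each linear factor; a zero at 0 just gives the
  factor 1. This moves the top coefficients of \<open>p\<close>, which Vieta's formulas concern, to
  the low indices.\<close>

lemma reflect_poly_decompose_list:
  fixes p :: "complex poly"
  assumes "mset zs = proots p"
  shows "reflect_poly p = smult (lead_coeff p) (\<Prod>z\<leftarrow>zs. [:1, - z:])"
  by (subst complex_poly_decompose_list[OF assms])
    (simp add: reflect_poly_smult reflect_poly_prod_list o_def reflect_poly_linear)

text \<open>A nonzero constant coefficient keeps 0 from being a zero, so every reversed factor
  \<open>[:1, - z:]\<close> is still linear and contributes exactly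
  \<open>inverse z\<close>.\<close>

lemma proots_reflect_poly:
  fixes p :: "complex poly"
  assumes "coeff p 0 \<noteq> 0"
  shows "proots (reflect_poly p) = image_mset inverse (proots p)"
proof -
  have p: "p \<noteq> 0"
    using assms by auto
  obtain zs where zs: "mset zs = proots p"
    using ex_mset by blast
  have nz: "z \<noteq> 0" if "z \<in> set zs" for z
  proof
    assume "z = 0"
    then have "0 \<in># proots p"
      using that zs by (metis set_mset_mset)
    then show False
      using p assms by (simp add: poly_0_coeff_0)
  qed
  have linear: "proots [:1, - z:] = {#inverse z#}" if "z \<noteq> 0" for z :: complex
  proof -
    have "[:1, - z:] = smult (- z) [:- inverse z, 1:]"
      using that by simp
    then show ?thesis
      using that by (metis proots_smult proots_linear_factor minus_minus neg_equal_0_iff_equal)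
  qed
  have "proots (reflect_poly p) = proots (\<Prod>z\<leftarrow>zs. [:1, - z:])"
    using p by (simp add: reflect_poly_decompose_list[OF zs])
  also have "\<dots> = image_mset inverse (mset zs)"
    using nz
  proof (induction zs)
    case (Cons z zs)
    have "proots ([:1, - z:] * (\<Prod>z\<leftarrow>zs. [:1, - z:])) =
        proots [:1, - z:] + proots (\<Prod>z\<leftarrow>zs. [:1, - z:])"
      by (rule proots_mult) (auto simp: prod_list_zero_iff)
    with Cons linear[of z] show ?case
      by simp
  qed simp
  finally show ?thesis
    by (simp add: zs)
qed

text \<open>By symmetry of the binomial coefficients. The condition on \<open>b m\<close> fixes the
  degree at \<open>m\<close>, hence the index about which the coefficients are reversed.\<close>

lemma reflect_poly_binomial_form:
  assumes "b m \<noteq> 0"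
  shows "reflect_poly (map_poly complex_of_real (binomial_form m b)) =
    map_poly complex_of_real (binomial_form m (\<lambda>k. b (m - k)))"
proof (rule poly_eqI)
  fix k
  have "degree (map_poly complex_of_real (binomial_form m b)) = m"
    using assms by (simp add: degree_map_poly degree_binomial_form)
  then show "coeff (reflect_poly (map_poly complex_of_real (binomial_form m b))) k =
      coeff (map_poly complex_of_real (binomial_form m (\<lambda>k. b (m - k)))) k"
    by (cases "k \<le> m")
      (auto simp: coeff_reflect_poly coeff_map_poly coeff_binomial_form
        binomial_symmetric[symmetric])
qed

lemma zeros_of_inverse:
  assumes "zeros_of zs (binomial_form m b)" "b 0 \<noteq> 0" "b m \<noteq> 0"
  shows "zeros_of (map inverse zs) (binomial_form m (\<lambda>k. b (m - k)))"
proof -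
  have "coeff (map_poly complex_of_real (binomial_form m b)) 0 \<noteq> 0"
    using assms by (simp add: coeff_map_poly coeff_binomial_form)
  from proots_reflect_poly[OF this] show ?thesis
    using assms by (simp add: zeros_of_def reflect_poly_binomial_form)
qed

section \<open>Evaluation of the two sums for one binomial form\<close>

lemma real_choose_two: "2 * real (m choose 2) = real m * (real m - 1)"
  by (cases m) (auto simp: choose_two field_simps real_of_nat_div)

lemma sum_sq_diffs_zeros_of_binomial_form:
  assumes zeros: "zeros_of zs (binomial_form m b)" and m: "m \<ge> 2" and bm: "b m \<noteq> 0"
  shows "sum_sq_diffs zs =
    complex_of_real (real (m\<^sup>2 * (m - 1)) * quadratic_element b (m - 1) / (b m)\<^sup>2)"
proof -
  define P where "P = map_poly complex_of_real (binomial_form m b)"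
  define Q where "Q = (\<Prod>z\<leftarrow>zs. [:1, - z:])"
  have zP: "mset zs = proots P"
    using zeros by (simp add: zeros_of_def P_def)
  have deg: "degree P = m"
    using bm by (simp add: P_def degree_map_poly degree_binomial_form)
  have len: "length zs = m"
    using size_proots_complex[of P] deg zP by (metis size_mset)
  \<comment> \<open>Vieta's formulas, obtained by computing coefficient \<open>k\<close> of the
    reflected polynomial in two ways.\<close>
  have refl: "complex_of_real (real (m choose k) * b (m - k)) =
      complex_of_real (b m) * coeff Q k" if "k \<le> m" for k
  proof -
    have "coeff (reflect_poly P) k = complex_of_real (real (m choose k) * b (m - k))"
      using that deg by (simp add: coeff_reflect_poly P_def coeff_map_poly coeff_binomial_form
          binomial_symmetric[symmetric])
    moreover have "lead_coeff P = complex_of_real (b m)"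
      unfolding deg by (simp add: P_def coeff_map_poly coeff_binomial_form)
    ultimately show ?thesis
      by (simp add: reflect_poly_decompose_list[OF zP] Q_def)
  qed
  note Q = coeff_prod_list_one_minus[of zs, folded Q_def]
  define B where "B k = complex_of_real (b k)" for k
  define M where "M = (of_nat m :: complex)"
  define S where "S = sum_list zs"
  define T where "T = (\<Sum>z\<leftarrow>zs. z\<^sup>2)"
  have S: "B m * S = - (M * B (m - 1))"
    using refl[of 1] m Q(2) by (simp add: B_def M_def S_def)
  have "2 * (of_nat (m choose 2) * B (m - 2)) = B m * (2 * coeff Q 2)"
    using refl[of 2] m by (simp add: B_def)
  then have "2 * of_nat (m choose 2) * B (m - 2) = B m * (S\<^sup>2 - T)"
    unfolding Q(3) S_def T_def by (simp only: mult.assoc)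
  moreover have "2 * of_nat (m choose 2) = M * (M - 1)"
    using arg_cong[OF real_choose_two, of complex_of_real m] by (simp add: M_def)
  ultimately have T: "B m * T = B m * S\<^sup>2 - M * (M - 1) * B (m - 2)"
    by (simp add: algebra_simps)
  \<comment> \<open>Scaling by the squared leading coefficient makes \<open>S\<close> and
    \<open>T\<close> occur only in the products \<open>B m * S\<close> and \<open>B m * T\<close>,
    so the equations above apply without division.\<close>
  have "(B m)\<^sup>2 * sum_sq_diffs zs = M * B m * (B m * T) - (B m * S)\<^sup>2"
    by (simp add: sum_sq_diffs_power_sums len M_def S_def T_def algebra_simps power2_eq_square)
  also have "\<dots> = M * (B m * S)\<^sup>2 - M * (M * (M - 1)) * B m * B (m - 2) - (B m * S)\<^sup>2"
    unfolding T by (simp add: algebra_simps power2_eq_square)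
  also have "\<dots> = M\<^sup>2 * (M - 1) * ((B (m - 1))\<^sup>2 - B (m - 2) * B m)"
    unfolding S by (simp add: algebra_simps power2_eq_square)
  finally have "(B m)\<^sup>2 * sum_sq_diffs zs =
      M\<^sup>2 * (M - 1) * ((B (m - 1))\<^sup>2 - B (m - 2) * B m)" .
  moreover have "complex_of_real (quadratic_element b (m - 1)) = (B (m - 1))\<^sup>2 - B (m - 2) * B m"
    using m by (simp add: quadratic_element_def B_def numeral_2_eq_2)
  moreover have "complex_of_real (real (m\<^sup>2 * (m - 1))) = M\<^sup>2 * (M - 1)"
    using m by (simp add: M_def of_nat_diff)
  moreover have "B m \<noteq> 0"
    using bm by (simp add: B_def)
  ultimately show ?thesis
    by (simp only: of_real_mult of_real_divide of_real_power B_def[symmetric])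
      (simp add: field_simps)
qed

lemma sum_sq_recip_diffs_zeros_of_binomial_form:
  assumes zeros: "zeros_of zs (binomial_form m b)" and m: "m \<ge> 2"
    and b: "b 0 \<noteq> 0" "b m \<noteq> 0"
  shows "sum_sq_recip_diffs zs =
    complex_of_real (real (m\<^sup>2 * (m - 1)) * quadratic_element b 1 / (b 0)\<^sup>2)"
proof -
  \<comment> \<open>Reversal sends the indices \<open>m - 2\<close>, \<open>m - 1\<close>,
    \<open>m\<close> to 2, 1, 0, so the last quadratic element becomes the first one.\<close>
  have "m - (m - 1) = 1" "m - (m - 1 - 1) = 2" "m - 1 + 1 = m"
    using m by auto
  then have "quadratic_element (\<lambda>k. b (m - k)) (m - 1) = quadratic_element b 1"
    by (simp add: quadratic_element_def numeral_2_eq_2)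
  with sum_sq_diffs_zeros_of_binomial_form[OF zeros_of_inverse[OF zeros b] m] b
  show ?thesis
    by (simp add: sum_sq_recip_diffs_eq)
qed

text \<open>In the first formula both sums belong to the same derivative and the degree factor
  cancels. In the second they belong to derivatives of degrees \<open>n - j + 1\<close> and
  \<open>n - k + 1\<close>, so a quotient of degree factors remains.\<close>

theorem mainTheorem4:
  fixes n :: nat and a :: "nat \<Rightarrow> real" and z :: "nat \<Rightarrow> complex list"
  assumes coeffs_nz: "\<forall>k\<le>n. a k \<noteq> 0"
    and quad_nz: "\<forall>k\<in>{1..n-1}. quadratic_element a k \<noteq> 0"
    and zeros: "\<forall>r<n. zeros_of (z r) ((pderiv ^^ r) (binomial_form n a))"
  shows "(\<forall>k\<in>{1..n-1}.
            complex_of_real (quadratic_element a k / quadratic_element a (n - 1)) =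
              complex_of_real ((a (k - 1))\<^sup>2 / (a n)\<^sup>2) *
              (sum_sq_recip_diffs (z (k - 1)) / sum_sq_diffs (z (k - 1)))) \<and>
         (\<forall>j\<in>{1..n-1}. \<forall>k\<in>{1..n-1}. j < k \<longrightarrow>
            complex_of_real (quadratic_element a j / quadratic_element a k) =
              of_nat ((n - k + 1)\<^sup>2 * (n - k)) / of_nat ((n - j + 1)\<^sup>2 * (n - j)) *
              complex_of_real ((a (j - 1))\<^sup>2 / (a (k - 1))\<^sup>2) *
              (sum_sq_recip_diffs (z (j - 1)) / sum_sq_recip_diffs (z (k - 1))))"
proof -
  \<comment> \<open>This is \<open>m\<^sup>2 * (m - 1)\<close> for the degree
    \<open>m = n - k + 1\<close> of the derivative of order \<open>k - 1\<close>.\<close>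
  define D where "D k = real ((n - k + 1)\<^sup>2 * (n - k))" for k
  have D_nz: "D k \<noteq> 0" if "k \<in> {1..n-1}" for k
    using that by (auto simp: D_def)
  have sums: "sum_sq_recip_diffs (z (k - 1)) =
        complex_of_real (D k * quadratic_element a k / (a (k - 1))\<^sup>2)"
      "sum_sq_diffs (z (k - 1)) =
        complex_of_real (D k * quadratic_element a (n - 1) / (a n)\<^sup>2)"
    if k: "k \<in> {1..n-1}" for k
  proof -
    define m where "m = n - (k - 1)"
    define b where "b i = a (i + (k - 1))" for i
    have m: "m \<ge> 2" "m = n - k + 1" "m - 1 = n - k"
      using k by (auto simp: m_def)
    have "zeros_of (z (k - 1)) ((pderiv ^^ (k - 1)) (binomial_form n a))"
      using zeros k by auto
    then have zb: "zeros_of (z (k - 1)) (binomial_form m b)"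
      using k by (subst (asm) zeros_of_higher_pderiv_binomial_form) (auto simp: m_def b_def[abs_def])
    have b: "b m = a n" "b 0 = a (k - 1)"
      using k by (auto simp: b_def m_def)
    then have nz: "b m \<noteq> 0" "b 0 \<noteq> 0"
      using coeffs_nz k by auto
    \<comment> \<open>Shifting by \<open>k - 1\<close> sends index 1 to \<open>k\<close> but the
      last index \<open>m - 1\<close> always to \<open>n - 1\<close>, whence the common denominator
      for all \<open>k\<close>.\<close>
    have "1 + (k - 1) = k" "1 - 1 + (k - 1) = k - 1" "1 + 1 + (k - 1) = k + 1"
      "m - 1 + (k - 1) = n - 1" "m - 1 - 1 + (k - 1) = n - 1 - 1" "m - 1 + 1 + (k - 1) = n - 1 + 1"
      using k by (auto simp: m_def)
    then have q: "quadratic_element b 1 = quadratic_element a k"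
      "quadratic_element b (m - 1) = quadratic_element a (n - 1)"
      unfolding quadratic_element_def b_def by (simp_all only:)
    have D: "real (m\<^sup>2 * (m - 1)) = D k"
      using m by (simp add: D_def)
    show "sum_sq_recip_diffs (z (k - 1)) =
        complex_of_real (D k * quadratic_element a k / (a (k - 1))\<^sup>2)"
      using sum_sq_recip_diffs_zeros_of_binomial_form[OF zb m(1) nz(2,1)]
      unfolding q D b .
    show "sum_sq_diffs (z (k - 1)) =
        complex_of_real (D k * quadratic_element a (n - 1) / (a n)\<^sup>2)"
      using sum_sq_diffs_zeros_of_binomial_form[OF zb m(1) nz(1)]
      unfolding q D b .
  qed
  have a_nz: "a (k - 1) \<noteq> 0" "a n \<noteq> 0" if "k \<in> {1..n-1}" for k
    using that coeffs_nz by auto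
  show ?thesis
  proof (intro conjI ballI impI)
    fix k assume k: "k \<in> {1..n-1}"
    then have "n - 1 \<in> {1..n-1}"
      by auto
    then have "quadratic_element a (n - 1) \<noteq> 0"
      using quad_nz by blast
    with D_nz[OF k] a_nz[OF k]
    have "quadratic_element a k / quadratic_element a (n - 1) =
        (a (k - 1))\<^sup>2 / (a n)\<^sup>2 * ((D k * quadratic_element a k / (a (k - 1))\<^sup>2) /
          (D k * quadratic_element a (n - 1) / (a n)\<^sup>2))"
      by (simp add: field_simps)
    then show "complex_of_real (quadratic_element a k / quadratic_element a (n - 1)) =
        complex_of_real ((a (k - 1))\<^sup>2 / (a n)\<^sup>2) *
        (sum_sq_recip_diffs (z (k - 1)) / sum_sq_diffs (z (k - 1)))"
      unfolding sums[OF k] by (simp only: of_real_mult of_real_divide)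
  next
    fix j k assume j: "j \<in> {1..n-1}" and k: "k \<in> {1..n-1}"
    have "quadratic_element a k \<noteq> 0"
      using quad_nz k by blast
    with D_nz[OF j] D_nz[OF k] a_nz[OF j] a_nz[OF k]
    \<comment> \<open>The factor \<open>D k / D j\<close> compensates for the
      \<open>D j / D k\<close> coming from the two sums.\<close>
    have eq: "quadratic_element a j / quadratic_element a k =
        D k / D j * ((a (j - 1))\<^sup>2 / (a (k - 1))\<^sup>2) *
        ((D j * quadratic_element a j / (a (j - 1))\<^sup>2) /
          (D k * quadratic_element a k / (a (k - 1))\<^sup>2))"
      by (simp add: field_simps)
    have of_D: "of_nat ((n - i + 1)\<^sup>2 * (n - i)) = complex_of_real (D i)" for i
      unfolding D_def of_real_of_nat_eq ..
    show "complex_of_real (quadratic_element a j / quadratic_element a k) =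
        of_nat ((n - k + 1)\<^sup>2 * (n - k)) / of_nat ((n - j + 1)\<^sup>2 * (n - j)) *
        complex_of_real ((a (j - 1))\<^sup>2 / (a (k - 1))\<^sup>2) *
        (sum_sq_recip_diffs (z (j - 1)) / sum_sq_recip_diffs (z (k - 1)))"
      unfolding sums[OF j] sums[OF k] of_D eq by (simp only: of_real_mult of_real_divide)
  qed
qed

end
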